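(* Let $m,n\ge 1$ be integers with $mn \ge 3$. For every vertex of $\mathrm{OFG}(M_{m,n})$, with corresponding height function $h$, the degree of that vertex in $\mathrm{OFG}(M_{m,n})$ equals the number of strict local extrema of $h$ on $G_{m,n}$.
   Context: $G_{m,n}$ is the grid graph with vertex set $\{(i,j): 1\le i\le m,\ 1\le j\le n\}$, each vertex joined to its horizontal and vertical neighbours. A proper $3$-colouring is a map $c:V(G_{m,n})\to\mathbb{Z}/3\mathbb{Z}$ with $c(u)\ne c(v)$ for every edge $uv$. $\mathrm{OFG}(M_{m,n})$ is the origami flip graph of the $m\times n$ Miura-ori (vertices: flat-foldable mountain--valley assignments; edges: single face flips). Throughout it is identified, by a known bijection, with the following simple graph: its vertices are the orbits of proper $3$-colourings of $G_{m,n}$ under the global colour rotation $c\mapsto c+1$ (action of $\mathbb{Z}/3\mathbb{Z}$), and two distinct orbits are adjacent if and only if they contain representatives that differ at exactly one vertex of $G_{m,n}$. A height function is a function $h:V(G_{m,n})\to\mathbb{Z}$ with $|h(u)-h(v)|=1$ for every edge $uv$. Reduction modulo $3$ gives a bijection between height functions normalised by $h(1,1)=0$ and vertices of $\mathrm{OFG}(M_{m,n})$; each vertex of $\mathrm{OFG}(M_{m,n})$ is identified with its normalised height function. A grid vertex $v$ is a strict local maximum of $h$ if every neighbour $u$ of $v$ satisfies $h(u)=h(v)-1$, a strict local minimum if every neighbour $u$ satisfies $h(u)=h(v)+1$, and a strict local extremum in either case. *)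

theory Defs
  imports Complex_Main "HOL-Library.FuncSet" "HOL-Library.Numeral_Type"
begin

definition grid_verts :: "nat \<Rightarrow> nat \<Rightarrow> (nat \<times> nat) set" where
  "grid_verts m n = {1..m} \<times> {1..n}"

definition grid_adj :: "nat \<Rightarrow> nat \<Rightarrow> nat \<times> nat \<Rightarrow> nat \<times> nat \<Rightarrow> bool" where
  "grid_adj m n u v \<longleftrightarrow> u \<in> grid_verts m n \<and> v \<in> grid_verts m n \<and>
     (fst u = fst v \<and> (snd v = snd u + 1 \<or> snd u = snd v + 1) \<or>
      snd u = snd v \<and> (fst v = fst u + 1 \<or> fst u = fst v + 1))"

text \<open>The numeral type \<^typ>\<open>3\<close> is the ring of integers modulo 3.  Functions on the grid are
  extensional (equal to \<^term>\<open>undefined\<close> off the vertex set), so that equality of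
  colourings, and of height functions, is equality on the grid.\<close>

definition proper_colourings :: "nat \<Rightarrow> nat \<Rightarrow> (nat \<times> nat \<Rightarrow> 3) set" where
  "proper_colourings m n =
     {c \<in> grid_verts m n \<rightarrow>\<^sub>E UNIV. \<forall>u v. grid_adj m n u v \<longrightarrow> c u \<noteq> c v}"

definition colour_orbit :: "nat \<Rightarrow> nat \<Rightarrow> (nat \<times> nat \<Rightarrow> 3) \<Rightarrow> (nat \<times> nat \<Rightarrow> 3) set" where
  "colour_orbit m n c = range (\<lambda>a::3. \<lambda>v\<in>grid_verts m n. c v + a)"

text \<open>The origami flip graph of the \<open>m\<close> by \<open>n\<close> Miura-ori, in its colouring model.\<close>

definition ofg_verts :: "nat \<Rightarrow> nat \<Rightarrow> (nat \<times> nat \<Rightarrow> 3) set set" where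
  "ofg_verts m n = colour_orbit m n ` proper_colourings m n"

definition ofg_adj ::
    "nat \<Rightarrow> nat \<Rightarrow> (nat \<times> nat \<Rightarrow> 3) set \<Rightarrow> (nat \<times> nat \<Rightarrow> 3) set \<Rightarrow> bool" where
  "ofg_adj m n X Y \<longleftrightarrow> X \<in> ofg_verts m n \<and> Y \<in> ofg_verts m n \<and> X \<noteq> Y \<and>
     (\<exists>c\<in>X. \<exists>d\<in>Y. \<exists>!v. v \<in> grid_verts m n \<and> c v \<noteq> d v)"

definition ofg_degree :: "nat \<Rightarrow> nat \<Rightarrow> (nat \<times> nat \<Rightarrow> 3) set \<Rightarrow> nat" where
  "ofg_degree m n X = card {Y \<in> ofg_verts m n. ofg_adj m n X Y}"

definition height_functions :: "nat \<Rightarrow> nat \<Rightarrow> (nat \<times> nat \<Rightarrow> int) set" where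
  "height_functions m n =
     {h \<in> grid_verts m n \<rightarrow>\<^sub>E UNIV. \<forall>u v. grid_adj m n u v \<longrightarrow> \<bar>h u - h v\<bar> = 1}"

definition normalised_heights :: "nat \<Rightarrow> nat \<Rightarrow> (nat \<times> nat \<Rightarrow> int) set" where
  "normalised_heights m n = {h \<in> height_functions m n. h (1, 1) = 0}"

definition height_to_ofg :: "nat \<Rightarrow> nat \<Rightarrow> (nat \<times> nat \<Rightarrow> int) \<Rightarrow> (nat \<times> nat \<Rightarrow> 3) set" where
  "height_to_ofg m n h = colour_orbit m n (\<lambda>v\<in>grid_verts m n. of_int (h v))"

text \<open>Reduction modulo 3 maps \<^term>\<open>normalised_heights m n\<close> bijectively onto
  \<^term>\<open>ofg_verts m n\<close> when \<open>m, n \<ge> 1\<close>; the height function of a vertex is its unique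
  preimage.\<close>

definition height_of :: "nat \<Rightarrow> nat \<Rightarrow> (nat \<times> nat \<Rightarrow> 3) set \<Rightarrow> (nat \<times> nat \<Rightarrow> int)" where
  "height_of m n = the_inv_into (normalised_heights m n) (height_to_ofg m n)"

definition strict_local_max :: "nat \<Rightarrow> nat \<Rightarrow> (nat \<times> nat \<Rightarrow> int) \<Rightarrow> nat \<times> nat \<Rightarrow> bool" where
  "strict_local_max m n h v \<longleftrightarrow> (\<forall>u. grid_adj m n v u \<longrightarrow> h u = h v - 1)"

definition strict_local_min :: "nat \<Rightarrow> nat \<Rightarrow> (nat \<times> nat \<Rightarrow> int) \<Rightarrow> nat \<times> nat \<Rightarrow> bool" where
  "strict_local_min m n h v \<longleftrightarrow> (\<forall>u. grid_adj m n v u \<longrightarrow> h u = h v + 1)"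

definition strict_local_extrema :: "nat \<Rightarrow> nat \<Rightarrow> (nat \<times> nat \<Rightarrow> int) \<Rightarrow> (nat \<times> nat) set" where
  "strict_local_extrema m n h =
     {v \<in> grid_verts m n. strict_local_max m n h v \<or> strict_local_min m n h v}"

end

theory Submission imports Defs begin

text \<open>A proper 3-colouring changes by \<open>\<plusminus>1\<close> along each edge, and around a unit square these four
  signed steps cancel already in \<open>\<int>\<close>, so they integrate to a height function.  A single vertex of the
  colouring can be recoloured only if all its neighbours share a colour, that is, if it is a strict
  local extremum of the height function, and then in exactly one way, namely by moving the height by
  two.  If a third vertex is available, the flips at two different vertices cannot be matched by a
  global rotation, as that vertex pins the rotation to zero.\<close>

section \<open>Residues modulo 3 and their signed integer lifts\<close>

lemma of_int_3_eq_iff: "(of_int x :: 3) = of_int y \<longleftrightarrow> 3 dvd x - y"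
proof -
  have three: "(3::3) = 0"
    by simp
  have *: "(of_int z :: 3) = 0 \<longleftrightarrow> 3 dvd z" for z
  proof -
    have "(of_int z :: 3) = of_int (3 * (z div 3) + z mod 3)"
      by simp
    also have "\<dots> = of_int (z mod 3)"
      using three by (simp only: of_int_add of_int_mult of_int_numeral) simp
    finally have eq: "(of_int z :: 3) = of_int (z mod 3)" .
    have "z mod 3 = 0 \<or> z mod 3 = 1 \<or> z mod 3 = 2"
      by presburger
    then show ?thesis
      using eq by (auto simp: dvd_eq_mod_eq_0)
  qed
  show ?thesis
    using *[of "x - y"] by simp
qed

text \<open>The representative of least absolute value. A nonzero colour difference thus becomes a
  step of 1 or -1, as a height function requires.\<close>

definition signed_lift :: "3 \<Rightarrow> int" where
  "signed_lift a = (if a = 0 then 0 else if a = 1 then 1 else - 1)"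

lemma cases_3: "(a::3) = 0 \<or> a = 1 \<or> a = 2"
proof (cases a)
  case (of_int z)
  then have "z = 0 \<or> z = 1 \<or> z = 2"
    by auto
  with of_int show ?thesis by auto
qed

lemma of_int_signed_lift [simp]: "of_int (signed_lift a) = a"
  using cases_3[of a] by (auto simp: signed_lift_def)

lemma signed_lift_minus: "signed_lift (- a) = - signed_lift a"
  using cases_3[of a] by (auto simp: signed_lift_def)

lemma abs_signed_lift: "a \<noteq> 0 \<Longrightarrow> \<bar>signed_lift a\<bar> = 1"
  by (simp add: signed_lift_def)

text \<open>Each side is a sum of two terms from {-1, 1}, hence -2, 0 or 2, and these three values
  are distinct modulo 3. This is the closedness condition on a unit square, for two paths between
  opposite corners.\<close>

lemma signed_lift_square:
  assumes "a + b = c + d" "a \<noteq> 0" "b \<noteq> 0" "c \<noteq> 0" "d \<noteq> 0"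
  shows "signed_lift a + signed_lift b = signed_lift c + signed_lift d"
  using assms cases_3[of a] cases_3[of b] cases_3[of c] cases_3[of d]
  by (auto simp: signed_lift_def)

section \<open>Edges, connectedness and neighbours in the grid\<close>

lemma grid_adj_sym: "grid_adj m n u v \<Longrightarrow> grid_adj m n v u"
  by (auto simp: grid_adj_def)

text \<open>Up to orientation an edge raises exactly one coordinate by one, so a property stable
  under reversal needs checking only for these two directions.\<close>

lemma grid_adj_induct [consumes 1, case_names sym fst snd]:
  assumes "grid_adj m n u v"
    and sym: "\<And>u v. grid_adj m n u v \<Longrightarrow> P u v \<Longrightarrow> P v u"
    and "\<And>i j. i \<in> {1..<m} \<Longrightarrow> j \<in> {1..n} \<Longrightarrow> P (i, j) (Suc i, j)"
    and "\<And>i j. i \<in> {1..m} \<Longrightarrow> j \<in> {1..<n} \<Longrightarrow> P (i, j) (i, Suc j)"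
  shows "P u v"
proof (cases u; cases v)
  fix i j k l assume [simp]: "u = (i, j)" "v = (k, l)"
  have range: "i \<in> {1..m}" "k \<in> {1..m}" "j \<in> {1..n}" "l \<in> {1..n}"
    using assms(1) by (auto simp: grid_adj_def grid_verts_def)
  consider "i = k" "l = Suc j" | "i = k" "j = Suc l" | "j = l" "k = Suc i" | "j = l" "i = Suc k"
    using assms(1) by (auto simp: grid_adj_def)
  then show ?thesis
  proof cases
    case 1 then show ?thesis using range assms(4) by simp
  next
    case 2 then show ?thesis
      using range assms(4)[of i l] assms(1) by (auto intro!: sym dest: grid_adj_sym)
  next
    case 3 then show ?thesis using range assms(3) by simp
  next
    case 4 then show ?thesis
      using range assms(3)[of k j] assms(1) by (auto intro!: sym dest: grid_adj_sym)
  qed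
qed

text \<open>Connectedness of the grid as an induction rule: (i, j) is reached from (1, 1) by first
  raising the first coordinate and then the second.\<close>

lemma grid_verts_induct [consumes 1, case_names origin step]:
  assumes "v \<in> grid_verts m n" and "P (1, 1)"
    and step: "\<And>u v. grid_adj m n u v \<Longrightarrow> P u \<Longrightarrow> P v"
  shows "P v"
proof -
  obtain i j where v: "v = (i, j)" and ij: "1 \<le> i" "i \<le> m" "1 \<le> j" "j \<le> n"
    using assms(1) by (auto simp: grid_verts_def)
  have "P (i, 1)"
    using ij(1,2)
  proof (induction i rule: nat_induct_at_least)
    case (Suc i)
    then show ?case
      using ij by (intro step[of "(i, 1)" "(Suc i, 1)"]) (auto simp: grid_adj_def grid_verts_def)
  qed (use assms in simp)
  with ij(3,4) have "P (i, j)"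
  proof (induction j rule: nat_induct_at_least)
    case (Suc j)
    then show ?case
      using ij by (intro step[of "(i, j)" "(i, Suc j)"]) (auto simp: grid_adj_def grid_verts_def)
  qed simp
  then show ?thesis by (simp add: v)
qed

lemma card_grid_verts: "card (grid_verts m n) = m * n"
  by (simp add: grid_verts_def)

lemma finite_grid_verts [simp]: "finite (grid_verts m n)"
  by (simp add: grid_verts_def)

lemma grid_vert_has_neighbour:
  assumes "v \<in> grid_verts m n" and "m * n \<ge> 2"
  obtains u where "grid_adj m n v u"
proof -
  obtain i j where v: "v = (i, j)" and ij: "1 \<le> i" "i \<le> m" "1 \<le> j" "j \<le> n"
    using assms(1) by (auto simp: grid_verts_def)
  have "m \<ge> 2 \<or> n \<ge> 2"
  proof (rule ccontr)
    assume "\<not> (m \<ge> 2 \<or> n \<ge> 2)"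
    then have "m * n \<le> 1 * 1" by (intro mult_le_mono) auto
    with assms(2) show False by simp
  qed
  then consider "i < m" | "i > 1" | "j < n" | "j > 1"
    using ij by linarith
  then show ?thesis
    using that[of "(Suc i, j)"] that[of "(i - 1, j)"] that[of "(i, Suc j)"] that[of "(i, j - 1)"] ij
    by cases (simp_all add: v grid_adj_def grid_verts_def, linarith+)
qed

section \<open>Orbits under colour rotation\<close>

lemma colour_orbit_memD:
  assumes "d \<in> colour_orbit m n c"
  obtains a where "d = (\<lambda>v\<in>grid_verts m n. c v + a)"
  using assms by (auto simp: colour_orbit_def)

lemma colour_orbit_eqI:
  assumes "\<And>v. v \<in> grid_verts m n \<Longrightarrow> d v = c v + a"
  shows "colour_orbit m n c = colour_orbit m n d"
proof -
  have "(\<lambda>v\<in>grid_verts m n. d v + b) = (\<lambda>v\<in>grid_verts m n. c v + (a + b))" for b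
    using assms by (intro restrict_ext) (simp add: add.assoc)
  \<comment> \<open>Adding \<open>a\<close> permutes the residues, so both orbits are the image of
    the full set of rotations.\<close>
  then have "colour_orbit m n d = (\<lambda>b. \<lambda>v\<in>grid_verts m n. c v + b) ` range ((+) a)"
    unfolding colour_orbit_def image_image by (rule image_cong[OF refl])
  then show ?thesis
    by (simp only: surj_plus colour_orbit_def)
qed

lemma colour_orbit_eqD:
  assumes "colour_orbit m n c = colour_orbit m n d"
  obtains a where "\<And>v. v \<in> grid_verts m n \<Longrightarrow> d v = c v + a"
proof -
  have "(\<lambda>v\<in>grid_verts m n. d v + 0) \<in> colour_orbit m n c"
    unfolding assms unfolding colour_orbit_def by (rule rangeI)
  then obtain a where eq: "(\<lambda>v\<in>grid_verts m n. d v + 0) = (\<lambda>v\<in>grid_verts m n. c v + a)"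
    by (rule colour_orbit_memD)
  have "d v = c v + a" if "v \<in> grid_verts m n" for v
    using fun_cong[OF eq, of v] that by simp
  then show ?thesis by (rule that)
qed

section \<open>Bijection between normalised height functions and orbits\<close>

lemma height_step:
  "h \<in> height_functions m n \<Longrightarrow> grid_adj m n u v \<Longrightarrow> h v = h u + 1 \<or> h v = h u - 1"
  unfolding height_functions_def by fastforce

lemma height_reduction_proper:
  assumes "h \<in> height_functions m n"
  shows "(\<lambda>v\<in>grid_verts m n. of_int (h v)) \<in> proper_colourings m n"
  using height_step[OF assms]
  by (fastforce simp: proper_colourings_def of_int_3_eq_iff grid_adj_def)

lemma height_to_ofg_in_verts: "h \<in> height_functions m n \<Longrightarrow> height_to_ofg m n h \<in> ofg_verts m n"
  by (simp add: height_to_ofg_def ofg_verts_def height_reduction_proper)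

lemma height_to_ofg_eqD:
  assumes "height_to_ofg m n h = height_to_ofg m n k"
  obtains a where "\<And>v. v \<in> grid_verts m n \<Longrightarrow> (of_int (k v) :: 3) = of_int (h v) + a"
proof -
  obtain a where "\<And>v. v \<in> grid_verts m n \<Longrightarrow>
      (\<lambda>v\<in>grid_verts m n. of_int (k v)) v = (\<lambda>v\<in>grid_verts m n. of_int (h v)) v + (a::3)"
    using assms[unfolded height_to_ofg_def] by (rule colour_orbit_eqD) blast
  then show ?thesis
    by (intro that[of a]) (metis restrict_apply')
qed

text \<open>Normalisation at (1, 1) forces the rotation to be zero, so the two functions agree
  modulo 3. If they agree at \<open>u\<close>, then at a neighbour they differ by -2, 0 or 2, and
  only 0 is divisible by 3; equality therefore spreads over the grid.\<close>

lemma inj_on_height_to_ofg: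
  assumes "m \<ge> 1" "n \<ge> 1"
  shows "inj_on (height_to_ofg m n) (normalised_heights m n)"
proof (rule inj_onI)
  fix h k
  assume h: "h \<in> normalised_heights m n" and k: "k \<in> normalised_heights m n"
    and "height_to_ofg m n h = height_to_ofg m n k"
  then obtain a where a: "\<And>v. v \<in> grid_verts m n \<Longrightarrow> (of_int (k v) :: 3) = of_int (h v) + a"
    using height_to_ofg_eqD by blast
  have hf: "h \<in> height_functions m n" "k \<in> height_functions m n" and "h (1,1) = 0" "k (1,1) = 0"
    using h k by (auto simp: normalised_heights_def)
  with a[of "(1,1)"] assms have "a = 0"
    by (simp add: grid_verts_def)
  with a have cong: "3 dvd k v - h v" if "v \<in> grid_verts m n" for v
    using that by (simp flip: of_int_3_eq_iff)
  have "k v = h v" if "v \<in> grid_verts m n" for v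
    using that
  proof (induction rule: grid_verts_induct)
    case origin
    then show ?case using \<open>h (1,1) = 0\<close> \<open>k (1,1) = 0\<close> by simp
  next
    case (step u v)
    have "3 dvd k v - h v"
      using step(1) by (intro cong) (simp add: grid_adj_def)
    then show ?case
      using height_step[OF hf(1) step(1)] height_step[OF hf(2) step(1)] step(2) by presburger
  qed
  moreover have "h \<in> extensional (grid_verts m n)" "k \<in> extensional (grid_verts m n)"
    using hf by (simp_all add: height_functions_def PiE_def)
  ultimately show "h = k"
    by (metis extensionalityI)
qed

lemma proper_colouring_has_height:
  assumes c: "c \<in> proper_colourings m n" and "m \<ge> 1" "n \<ge> 1"
  obtains h where "h \<in> normalised_heights m n" "height_to_ofg m n h = colour_orbit m n c"
proof -
  define s where "s = (\<lambda>u v. signed_lift (c v - c u))"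
  \<comment> \<open>Integration of the signed steps along a fixed path from (1, 1): first through
    (k, 1), then through (i, l).\<close>
  define H where "H = (\<lambda>(i, j). (\<Sum>k=1..<i. s (k, 1) (Suc k, 1)) + (\<Sum>l=1..<j. s (i, l) (i, Suc l)))"
  have neq: "c u \<noteq> c v" if "grid_adj m n u v" for u v
    using c that unfolding proper_colourings_def by blast
  \<comment> \<open>For j = 1 the edge lies on the integration path. Passing from j to j + 1 uses
    the unit square between them, around which the steps cancel.\<close>
  have vertical: "H (Suc i, j) - H (i, j) = s (i, j) (Suc i, j)"
    if i: "i \<in> {1..<m}" and j: "1 \<le> j" "j \<le> n" for i j
    using j
  proof (induction j rule: nat_induct_at_least)
    case base
    then show ?case using i by (simp add: H_def)
  next
    case (Suc j)
    have "s (i, j) (Suc i, j) + s (Suc i, j) (Suc i, Suc j)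
        = s (i, j) (i, Suc j) + s (i, Suc j) (Suc i, Suc j)"
      unfolding s_def using i Suc.hyps Suc.prems
        neq[of "(i, j)" "(Suc i, j)"] neq[of "(Suc i, j)" "(Suc i, Suc j)"]
        neq[of "(i, j)" "(i, Suc j)"] neq[of "(i, Suc j)" "(Suc i, Suc j)"]
      by (intro signed_lift_square) (auto simp: grid_adj_def grid_verts_def)
    moreover have "H (k, Suc j) = H (k, j) + s (k, j) (k, Suc j)" for k
      using Suc.hyps by (simp add: H_def)
    ultimately show ?case
      using Suc by simp
  qed
  have edge: "H v - H u = s u v" if "grid_adj m n u v" for u v
    using that
  proof (induction rule: grid_adj_induct)
    case (sym u v)
    then show ?case
      using signed_lift_minus[of "c v - c u"] by (simp add: s_def)
  next
    case (fst i j)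
    then show ?case using vertical by simp
  next
    case (snd i j)
    then show ?case by (simp add: H_def)
  qed
  \<comment> \<open>Modulo 3 a signed step is the colour difference itself, so the sum telescopes;
    \<open>H\<close> recovers \<open>c\<close> up to rotation by \<open>c (1, 1)\<close>.\<close>
  have reduce: "of_int (H v) = c v - c (1, 1)" if "v \<in> grid_verts m n" for v
    using that
  proof (induction rule: grid_verts_induct)
    case origin
    then show ?case by (simp add: H_def)
  next
    case (step u v)
    have "H v = H u + s u v"
      using edge[OF step(1)] by simp
    then show ?case
      using step(2) by (simp add: s_def)
  qed
  define h where "h = restrict H (grid_verts m n)"
  have "\<bar>h u - h v\<bar> = 1" if "grid_adj m n u v" for u v
    using edge[OF grid_adj_sym[OF that]] neq[OF that] that
    by (auto simp: h_def s_def grid_adj_def abs_signed_lift)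
  moreover have "h (1, 1) = 0"
    using assms by (simp add: h_def H_def grid_verts_def)
  ultimately have "h \<in> normalised_heights m n"
    by (auto simp: normalised_heights_def height_functions_def h_def)
  moreover have "height_to_ofg m n h = colour_orbit m n c"
    unfolding height_to_ofg_def
    by (rule colour_orbit_eqI[where a = "c (1, 1)"]) (simp add: h_def reduce)
  ultimately show ?thesis by (rule that)
qed

lemma
  assumes "m \<ge> 1" "n \<ge> 1" and "X \<in> ofg_verts m n"
  shows height_of_normalised: "height_of m n X \<in> normalised_heights m n"
    and height_to_ofg_height_of: "height_to_ofg m n (height_of m n X) = X"
proof -
  have "X \<in> height_to_ofg m n ` normalised_heights m n"
    using assms by (auto simp: ofg_verts_def elim!: proper_colouring_has_height)
  then show "height_of m n X \<in> normalised_heights m n" "height_to_ofg m n (height_of m n X) = X"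
    unfolding height_of_def
    using inj_on_height_to_ofg[OF assms(1,2)]
    by (simp_all add: the_inv_into_into f_the_inv_into_f)
qed

section \<open>Flips at local extrema\<close>

definition flip :: "nat \<Rightarrow> nat \<Rightarrow> (nat \<times> nat \<Rightarrow> int) \<Rightarrow> nat \<times> nat \<Rightarrow> nat \<times> nat \<Rightarrow> int" where
  "flip m n h v = h(v := h v + (if strict_local_max m n h v then - 2 else 2))"

text \<open>All neighbours of an extremum share one height, and the flip reflects \<open>h v\<close>
  in it; one formula thus covers maxima and minima.\<close>

lemma flip_at:
  assumes "h \<in> height_functions m n" "v \<in> strict_local_extrema m n h" "grid_adj m n v u"
  shows "flip m n h v v = 2 * h u - h v"
proof (cases "strict_local_max m n h v")
  case True
  then have "h u = h v - 1"
    using assms(3) unfolding strict_local_max_def by blast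
  with True show ?thesis by (simp add: flip_def)
next
  case False
  then have "h u = h v + 1"
    using assms(2,3) unfolding strict_local_extrema_def strict_local_min_def by blast
  with False show ?thesis by (simp add: flip_def)
qed

lemma flip_other [simp]: "x \<noteq> v \<Longrightarrow> flip m n h v x = h x"
  by (simp add: flip_def)

text \<open>Reflection in the common neighbour height keeps the distance 1 to it, and edges avoiding
  \<open>v\<close> are unchanged.\<close>

lemma flip_height_function:
  assumes "h \<in> height_functions m n" and v: "v \<in> strict_local_extrema m n h"
  shows "flip m n h v \<in> height_functions m n"
proof -
  have "\<bar>flip m n h v x - flip m n h v y\<bar> = 1" if "grid_adj m n x y" for x y
  proof -
    have "x \<noteq> y" using that by (auto simp: grid_adj_def)
    moreover have "\<bar>h x - h y\<bar> = 1"
      using that assms(1) unfolding height_functions_def by blast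
    ultimately show ?thesis
      using that grid_adj_sym[OF that] flip_at[OF assms, of x] flip_at[OF assms, of y]
      by (cases "x = v"; cases "y = v") auto
  qed
  moreover have "flip m n h v \<in> grid_verts m n \<rightarrow>\<^sub>E UNIV"
    using assms by (auto simp: flip_def height_functions_def strict_local_extrema_def PiE_def extensional_def)
  ultimately show ?thesis
    by (auto simp: height_functions_def)
qed

lemma of_int_flip_eq_iff: "(of_int (flip m n h v x) :: 3) = of_int (h x) \<longleftrightarrow> x \<noteq> v"
  by (simp add: flip_def of_int_3_eq_iff)

text \<open>Supplies a vertex untouched by flips at \<open>u\<close> and \<open>v\<close>, where the
  rotation between the two colourings can be read off.\<close>

lemma third_grid_vert:
  assumes "m * n \<ge> 3"
  obtains x where "x \<in> grid_verts m n" "x \<noteq> u" "x \<noteq> v"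
proof -
  have "\<not> grid_verts m n \<subseteq> {u, v}"
  proof
    assume "grid_verts m n \<subseteq> {u, v}"
    then have "card (grid_verts m n) \<le> card {u, v}"
      by (intro card_mono) auto
    also have "\<dots> \<le> 2" by (simp add: card_insert_if)
    finally show False using assms by (simp add: card_grid_verts)
  qed
  then show ?thesis using that by blast
qed

text \<open>A vertex other than \<open>v\<close> keeps its colour, so a matching rotation would be
  zero; but at \<open>v\<close> the colour changes, since 2 is nonzero modulo 3.\<close>

lemma height_to_ofg_flip_neq:
  assumes "m * n \<ge> 3" and "v \<in> grid_verts m n"
  shows "height_to_ofg m n (flip m n h v) \<noteq> height_to_ofg m n h"
proof
  assume "height_to_ofg m n (flip m n h v) = height_to_ofg m n h"
  then obtain a where a: "\<And>x. x \<in> grid_verts m n \<Longrightarrow>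
      (of_int (flip m n h v x) :: 3) = of_int (h x) + a"
    by (metis height_to_ofg_eqD)
  obtain x where "x \<in> grid_verts m n" "x \<noteq> v"
    using third_grid_vert[OF assms(1)] by blast
  with a[of x] have "a = 0"
    by (metis add_left_cancel add.right_neutral of_int_flip_eq_iff)
  with a[OF assms(2)] show False
    by (simp add: of_int_flip_eq_iff)
qed

text \<open>A third vertex has the same colour after either flip, so the rotation is zero. At
  \<open>v\<close> only one of the two flips changes the colour, a contradiction.\<close>

lemma inj_on_height_to_ofg_flip:
  assumes "m * n \<ge> 3"
  shows "inj_on (\<lambda>v. height_to_ofg m n (flip m n h v)) (grid_verts m n)"
proof (rule inj_onI, rule ccontr)
  fix v w
  assume vw: "v \<in> grid_verts m n" "w \<in> grid_verts m n" "v \<noteq> w"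
    and "height_to_ofg m n (flip m n h v) = height_to_ofg m n (flip m n h w)"
  then obtain a where a: "\<And>x. x \<in> grid_verts m n \<Longrightarrow>
      (of_int (flip m n h w x) :: 3) = of_int (flip m n h v x) + a"
    by (metis height_to_ofg_eqD)
  obtain x where "x \<in> grid_verts m n" "x \<noteq> v" "x \<noteq> w"
    using third_grid_vert[OF assms] by blast
  with a[of x] have "a = 0"
    by (metis add_left_cancel add.right_neutral of_int_flip_eq_iff)
  with a[OF vw(1)] show False
    using vw(3) by (metis add.right_neutral of_int_flip_eq_iff)
qed

section \<open>Neighbours of an orbit in the flip graph\<close>

lemma third_colour_unique: "(x::3) \<noteq> p \<Longrightarrow> y \<noteq> p \<Longrightarrow> z \<noteq> p \<Longrightarrow> x \<noteq> z \<Longrightarrow> y \<noteq> z \<Longrightarrow> x = y"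
  using cases_3[of x] cases_3[of y] cases_3[of z] cases_3[of p] by auto

text \<open>The neighbours of \<open>v\<close> avoid both its old and its new colour, so they all
  have the third one. Conversely, the old colour and the neighbour colour leave a single choice for
  the new one, and the flip realises it.\<close>

lemma single_recolouring_is_flip:
  assumes h: "h \<in> height_functions m n" and "m * n \<ge> 2"
    and d: "d \<in> proper_colourings m n" and v: "v \<in> grid_verts m n"
    and dv: "d v \<noteq> of_int (h v)"
    and off: "\<And>x. x \<in> grid_verts m n \<Longrightarrow> x \<noteq> v \<Longrightarrow> d x = of_int (h x)"
  shows "v \<in> strict_local_extrema m n h" and "x \<in> grid_verts m n \<Longrightarrow> d x = of_int (flip m n h v x)"
proof -
  have nb: "d v \<noteq> of_int (h x)" if "grid_adj m n v x" for x
  proof -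
    have "x \<in> grid_verts m n" "x \<noteq> v"
      using that by (auto simp: grid_adj_def)
    moreover have "d v \<noteq> d x"
      using d that unfolding proper_colourings_def by blast
    ultimately show ?thesis
      using off by metis
  qed
  have same: "h x = h y" if "grid_adj m n v x" "grid_adj m n v y" for x y
  proof -
    have "(of_int (h x) :: 3) \<noteq> of_int (h v)" "(of_int (h y) :: 3) \<noteq> of_int (h v)"
      using height_step[OF h that(1)] height_step[OF h that(2)] by (auto simp: of_int_3_eq_iff)
    then have "(of_int (h x) :: 3) = of_int (h y)"
      using third_colour_unique[of "of_int (h x)" "of_int (h v)" "of_int (h y)" "d v"]
        nb[OF that(1)] nb[OF that(2)] dv by metis
    \<comment> \<open>Both heights lie at distance 1 from \<open>h v\<close>, so they differ by at
      most 2, and congruence modulo 3 means equality.\<close>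
    then show ?thesis
      using height_step[OF h that(1)] height_step[OF h that(2)] by (auto simp: of_int_3_eq_iff)
  qed
  obtain u where u: "grid_adj m n v u"
    using grid_vert_has_neighbour[OF v assms(2)] by blast
  show ext: "v \<in> strict_local_extrema m n h"
    using height_step[OF h u] same[OF u] v
    unfolding strict_local_extrema_def strict_local_max_def strict_local_min_def by fastforce
  have "(of_int (h u) :: 3) \<noteq> of_int (flip m n h v v)" "(of_int (h u) :: 3) \<noteq> of_int (h v)"
    using height_step[OF h u] flip_at[OF h ext u] by (auto simp: of_int_3_eq_iff)
  then have "d v = of_int (flip m n h v v)"
    using third_colour_unique[of "d v" "of_int (h u)" "of_int (flip m n h v v)" "of_int (h v)"]
      nb[OF u] dv of_int_flip_eq_iff[of m n h v v] by metis
  then show "d x = of_int (flip m n h v x)" if "x \<in> grid_verts m n"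
    using off[OF that] by (cases "x = v") (auto simp: flip_def)
qed

text \<open>Adjacency speaks of some pair of representatives. Rotating both by the same amount
  preserves where they differ, so the first may be taken to be a prescribed
  \<open>c0\<close>.\<close>

lemma ofg_neighbour_representative:
  assumes "Y \<in> ofg_verts m n" and "c \<in> colour_orbit m n c0" and "d \<in> Y"
  obtains d0 where "d0 \<in> proper_colourings m n" "Y = colour_orbit m n d0"
    "\<And>x. x \<in> grid_verts m n \<Longrightarrow> c0 x = d0 x \<longleftrightarrow> c x = d x"
proof -
  obtain e where e: "e \<in> proper_colourings m n" "Y = colour_orbit m n e"
    using assms(1) by (auto simp: ofg_verts_def)
  obtain a b where a: "c = (\<lambda>x\<in>grid_verts m n. c0 x + a)" and b: "d = (\<lambda>x\<in>grid_verts m n. e x + b)"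
    using assms(2,3) e(2) by (metis colour_orbit_memD)
  \<comment> \<open>Here \<open>b\<close> leads from \<open>e\<close> to \<open>d\<close>, and
    subtracting \<open>a\<close> undoes the rotation that leads from \<open>c0\<close> to
    \<open>c\<close>.\<close>
  define d0 where "d0 = (\<lambda>x\<in>grid_verts m n. e x + (b - a))"
  have "d0 \<in> proper_colourings m n"
    using e(1) by (auto simp: proper_colourings_def d0_def grid_adj_def)
  moreover have "Y = colour_orbit m n d0"
    unfolding e(2) by (rule colour_orbit_eqI) (simp add: d0_def)
  moreover have "c0 x = d0 x \<longleftrightarrow> c x = d x" if "x \<in> grid_verts m n" for x
    using that by (auto simp: a b d0_def algebra_simps)
  ultimately show ?thesis by (rule that)
qed

text \<open>An adjacent orbit has a representative differing from the reduction of \<open>h\<close>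
  at one vertex, hence arises by a flip there. Conversely, a flip changes one colour and, by the
  size bound, leads to a different orbit.\<close>

lemma ofg_neighbours:
  assumes h: "h \<in> height_functions m n" and mn: "m * n \<ge> 3"
  shows "{Y \<in> ofg_verts m n. ofg_adj m n (height_to_ofg m n h) Y}
    = (\<lambda>v. height_to_ofg m n (flip m n h v)) ` strict_local_extrema m n h" (is "?L = ?R")
proof (intro equalityI subsetI)
  fix Y assume "Y \<in> ?L"
  then obtain c d where Y: "Y \<in> ofg_verts m n" and c: "c \<in> height_to_ofg m n h" and d: "d \<in> Y"
    and "\<exists>!v. v \<in> grid_verts m n \<and> c v \<noteq> d v"
    by (auto simp: ofg_adj_def)
  then obtain v where v: "v \<in> grid_verts m n" "c v \<noteq> d v"
    and off: "\<And>x. x \<in> grid_verts m n \<Longrightarrow> x \<noteq> v \<Longrightarrow> c x = d x"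
    by metis
  obtain d0 where d0: "d0 \<in> proper_colourings m n" "Y = colour_orbit m n d0"
    and "\<And>x. x \<in> grid_verts m n \<Longrightarrow>
      (\<lambda>x\<in>grid_verts m n. of_int (h x)) x = d0 x \<longleftrightarrow> c x = d x"
    using ofg_neighbour_representative[OF Y c[unfolded height_to_ofg_def] d] by blast
  then have iff: "d0 x = of_int (h x) \<longleftrightarrow> c x = d x" if "x \<in> grid_verts m n" for x
    using that by (metis restrict_apply')
  have dv: "d0 v \<noteq> of_int (h v)" and doff: "\<And>x. x \<in> grid_verts m n \<Longrightarrow> x \<noteq> v \<Longrightarrow> d0 x = of_int (h x)"
    using iff v off by blast+
  have "m * n \<ge> 2" using mn by simp
  note fl = single_recolouring_is_flip[OF h this d0(1) v(1) dv doff]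
  have "height_to_ofg m n (flip m n h v) = Y"
    unfolding height_to_ofg_def d0(2)
    by (rule colour_orbit_eqI[where a = 0]) (simp add: fl(2))
  then show "Y \<in> ?R" using fl(1) by blast
next
  fix Y assume "Y \<in> ?R"
  then obtain v where v: "v \<in> strict_local_extrema m n h" and Y: "Y = height_to_ofg m n (flip m n h v)"
    by blast
  have vg: "v \<in> grid_verts m n" using v by (simp add: strict_local_extrema_def)
  have in_orbit: "(\<lambda>x\<in>grid_verts m n. of_int (k x)) \<in> height_to_ofg m n k" for k
    unfolding height_to_ofg_def colour_orbit_def
    by (rule range_eqI[where x = 0]) (auto intro: restrict_ext)
  have "\<exists>!x. x \<in> grid_verts m n \<and>
      (\<lambda>x\<in>grid_verts m n. of_int (h x) :: 3) x
        \<noteq> (\<lambda>x\<in>grid_verts m n. of_int (flip m n h v x)) x"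
    using vg by (intro ex1I[of _ v]) (metis restrict_apply' of_int_flip_eq_iff)+
  moreover have "Y \<in> ofg_verts m n" "height_to_ofg m n h \<in> ofg_verts m n"
    unfolding Y using height_to_ofg_in_verts flip_height_function[OF h v] h by blast+
  moreover have "height_to_ofg m n h \<noteq> Y"
    unfolding Y using height_to_ofg_flip_neq[OF mn vg] by metis
  ultimately show "Y \<in> ?L"
    unfolding ofg_adj_def using in_orbit[of h] in_orbit[of "flip m n h v"] Y by blast
qed

theorem lemma2p1:
  fixes m n :: nat and X :: "(nat \<times> nat \<Rightarrow> 3) set"
  assumes "m \<ge> 1" and "n \<ge> 1" and "m * n \<ge> 3"
    and "X \<in> ofg_verts m n"
  shows "ofg_degree m n X = card (strict_local_extrema m n (height_of m n X))"
proof -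
  define h where "h = height_of m n X"
  have h: "h \<in> height_functions m n" and X: "X = height_to_ofg m n h"
    using height_of_normalised[OF assms(1,2,4)] height_to_ofg_height_of[OF assms(1,2,4)]
    by (auto simp: h_def normalised_heights_def)
  \<comment> \<open>Distinct extrema give distinct neighbours, so counting neighbours amounts to
    counting extrema.\<close>
  have "inj_on (\<lambda>v. height_to_ofg m n (flip m n h v)) (strict_local_extrema m n h)"
    by (rule inj_on_subset[OF inj_on_height_to_ofg_flip[OF assms(3)]])
      (auto simp: strict_local_extrema_def)
  then have "ofg_degree m n X = card (strict_local_extrema m n h)"
    by (simp add: ofg_degree_def X ofg_neighbours[OF h assms(3)] card_image)
  then show ?thesis by (simp add: h_def)
qed

end
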